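(* Let $G$ be a countable amenable group acting on a compact metric space $(X,\rho)$. For $x\in X$ let $m(x)\in\mathbb N\cup\{\infty\}$ be the number of minimal components of $\overline{Gx}$. Then the function $m\colon(X,D_W)\to\mathbb N\cup\{\infty\}$ is lower semicontinuous, i.e. whenever $x,x_n\in X$ satisfy $D_W(x_n,x)\to0$ as $n\to\infty$, one has $\liminf_{n\to\infty}m(x_n)\ge m(x)$.
   Context: $G$ is a discrete countable amenable group with identity $e$; $(X,\rho)$ is a compact metric space of diameter at most $1$; $G$ acts on $X$ via a continuous map $G\times X\to X$, $(g,x)\mapsto gx$, with $ex=x$ and $g(hx)=(gh)x$. $\overline{Gx}$ is the closure of the orbit $Gx=\{gx:g\in G\}$. A minimal component of $\overline{Gx}$ is a minimal subset of it: a non-empty closed $G$-invariant subset in which every point has dense orbit. A (left) Følner sequence is a sequence $\{F_n\}$ of non-empty finite subsets of $G$ with $|gF_n\triangle F_n|/|F_n|\to0$ for every $g\in G$. Weyl pseudometric: for $x,z\in X$, $D_W(x,z)=\limsup_{n\to\infty}\frac1{|F_n|}\sup_{g\in G}\sum_{f\in F_ng}\rho(fx,fz)$ for a Følner sequence $\{F_n\}$ (the value does not depend on the Følner sequence). *)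

theory Defs
  imports "HOL-Analysis.Analysis" "HOL-Algebra.Group_Action"
begin

definition folner_sequence :: "('g, 'b) monoid_scheme \<Rightarrow> (nat \<Rightarrow> 'g set) \<Rightarrow> bool" where
  "folner_sequence G F \<longleftrightarrow>
     (\<forall>n. F n \<noteq> {} \<and> finite (F n) \<and> F n \<subseteq> carrier G) \<and>
     (\<forall>g\<in>carrier G.
        (\<lambda>n. real (card (sym_diff (g <#\<^bsub>G\<^esub> F n) (F n))) / real (card (F n))) \<longlonglongrightarrow> 0)"

text \<open>Used for countable groups only, where amenability means the existence of a Folner
  sequence.\<close>

definition amenable :: "('g, 'b) monoid_scheme \<Rightarrow> bool" where
  "amenable G \<longleftrightarrow> (\<exists>F. folner_sequence G F)"

text \<open>The inner supremum is a real one. It is a genuine supremum whenever the points range over a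
  bounded set, since then each sum is at most \<open>card (F n)\<close> times its diameter. The outer
  limes superior is taken in the extended reals, so that it always exists.\<close>

definition weyl_dist ::
  "('g, 'b) monoid_scheme \<Rightarrow> ('g \<Rightarrow> 'x \<Rightarrow> 'x) \<Rightarrow> (nat \<Rightarrow> 'g set) \<Rightarrow> 'x \<Rightarrow> 'x::metric_space \<Rightarrow> ereal" where
  "weyl_dist G \<phi> F x z =
     limsup (\<lambda>n. ereal (1 / real (card (F n)) *
       (SUP g\<in>carrier G. \<Sum>f\<in>F n #>\<^bsub>G\<^esub> g. dist (\<phi> f x) (\<phi> f z))))"

definition minimal_component ::
  "('g, 'b) monoid_scheme \<Rightarrow> ('g \<Rightarrow> 'x \<Rightarrow> 'x) \<Rightarrow> 'x::metric_space set \<Rightarrow> 'x set \<Rightarrow> bool" where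
  "minimal_component G \<phi> Y M \<longleftrightarrow>
     M \<subseteq> Y \<and> M \<noteq> {} \<and> closed M \<and> (\<forall>g\<in>carrier G. \<phi> g ` M \<subseteq> M) \<and>
     (\<forall>y\<in>M. closure (orbit G \<phi> y) = M)"

definition num_minimal_components ::
  "('g, 'b) monoid_scheme \<Rightarrow> ('g \<Rightarrow> 'x \<Rightarrow> 'x) \<Rightarrow> 'x::metric_space \<Rightarrow> enat" where
  "num_minimal_components G \<phi> x =
     (let \<M> = {M. minimal_component G \<phi> (closure (orbit G \<phi> x)) M}
      in if finite \<M> then enat (card \<M>) else \<infinity>)"

end

theory Submission
  imports Defs
begin

text \<open>
  The idea is to shadow any finitely many minimal components of \<open>closure (orbit G \<phi> x)\<close> by as
  many of \<open>closure (orbit G \<phi> z)\<close>, for every \<open>z\<close> sufficiently close to \<open>x\<close> in the Weyl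
  pseudometric.

  Closeness yields one finite nonempty set \<open>A\<close> of group elements such that the average
  of \<open>dist (\<phi> f (\<phi> g x)) (\<phi> f (\<phi> g z))\<close> over \<open>f \<in> A\<close> is at most \<open>\<epsilon>\<close> for \<^emph>\<open>all\<close> \<open>g\<close> at once.
  This bound depends only on finitely many continuous maps and is uniform along the orbit
  of the pair \<open>(x, z)\<close>, so it passes to the orbit closure of that pair in the product. Given a
  minimal component \<open>M\<close> for \<open>x\<close>, compactness supplies a pair \<open>(a, b)\<close> in this closure with
  \<open>a \<in> M\<close>. Since \<open>M\<close> is invariant, every point \<open>y\<close> of the orbit closure of \<open>b\<close> then has the
  property that the average distance from \<open>\<phi> f y\<close> to \<open>M\<close> over \<open>f \<in> A\<close> is at most \<open>\<epsilon>\<close>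
  (\<open>pair_average_le_imp_near_component\<close>). By Zorn's lemma this orbit closure contains a minimal
  set \<open>N\<close> (\<open>minimal_component_exists\<close>), which is a minimal component for \<open>z\<close>.

  Distinct minimal components are disjoint, so finitely many of them are separated by some
  \<open>\<delta> > 0\<close>. The translates \<open>\<phi> f y\<close> of one point cannot be closer on average than \<open>\<delta>/2\<close> to
  each of two sets that are at least \<open>\<delta>\<close> apart. Hence for
  \<open>2\<epsilon> < \<delta>\<close> the assignment of \<open>N\<close> to \<open>M\<close> is injective (\<open>minimal_components_shadowed\<close>), and \<open>z\<close> has
  at least as many minimal components as were chosen for \<open>x\<close>.
\<close>

section \<open>Minimal components of compact actions\<close>

locale compact_action = group_action G X \<phi>
  for G (structure) and X :: "'x::metric_space set" and \<phi> +
  assumes compact: "compact X"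
    and continuous: "g \<in> carrier G \<Longrightarrow> continuous_on X (\<phi> g)"
begin

sublocale group G
  using group_hom group_hom.axioms(1) by blast

lemma closed_space: "closed X"
  using compact by (rule compact_imp_closed)

lemma closed_subset_compact: "closed M \<Longrightarrow> M \<subseteq> X \<Longrightarrow> compact M"
  using closed_Int_compact[OF _ compact] by (metis Int_absorb2)

lemma act_closed [simp]: "g \<in> carrier G \<Longrightarrow> y \<in> X \<Longrightarrow> \<phi> g y \<in> X"
  by (rule element_image) auto

lemma orbit_closure_subset:
  assumes "closed M" "\<forall>g\<in>carrier G. \<phi> g ` M \<subseteq> M" "y \<in> M"
  shows "closure (orbit G \<phi> y) \<subseteq> M"
  using assms by (intro closure_minimal) (auto simp: orbit_def)

lemma orbit_closure_subset_space: "y \<in> X \<Longrightarrow> closure (orbit G \<phi> y) \<subseteq> X"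
  by (intro orbit_closure_subset closed_space) auto

lemma self_in_orbit_closure: "y \<in> X \<Longrightarrow> y \<in> closure (orbit G \<phi> y)"
  using orbit_refl closure_subset by blast

lemma orbit_closure_invariant:
  assumes "y \<in> X" "g \<in> carrier G"
  shows "\<phi> g ` closure (orbit G \<phi> y) \<subseteq> closure (orbit G \<phi> y)"
proof (rule image_closure_subset)
  show "continuous_on (closure (orbit G \<phi> y)) (\<phi> g)"
    using continuous[OF assms(2)] orbit_closure_subset_space[OF assms(1)] continuous_on_subset by blast
  have "\<phi> g ` orbit G \<phi> y \<subseteq> orbit G \<phi> y"
  proof (clarsimp simp: orbit_def)
    fix h assume "h \<in> carrier G"
    then show "\<exists>k. \<phi> g (\<phi> h y) = \<phi> k y \<and> k \<in> carrier G"
      using assms composition_rule[of y g h] by (intro exI[of _ "g \<otimes> h"]) auto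
  qed
  then show "\<phi> g ` orbit G \<phi> y \<subseteq> closure (orbit G \<phi> y)"
    using closure_subset by blast
qed simp

text \<open>Zorn's lemma is applied to the relative complements of closed invariant sets, so that a
  maximal complement is a minimal set; compactness keeps intersections of chains nonempty.\<close>

lemma minimal_component_exists:
  assumes y: "y \<in> X"
  shows "\<exists>N. minimal_component G \<phi> (closure (orbit G \<phi> y)) N"
proof -
  define K where "K = closure (orbit G \<phi> y)"
  define good where
    "good M \<longleftrightarrow> M \<noteq> {} \<and> closed M \<and> (\<forall>g\<in>carrier G. \<phi> g ` M \<subseteq> M)" for M
  define \<A> where "\<A> = {U. U \<subseteq> K \<and> good (K - U)}"
  have K: "K \<subseteq> X" "compact K" "good K"
    using orbit_closure_subset_space[OF y] orbit_closure_invariant[OF y]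
      self_in_orbit_closure[OF y]
    by (auto simp: K_def good_def intro: closed_subset_compact)
  have "\<exists>U\<in>\<A>. \<forall>V\<in>\<A>. U \<subseteq> V \<longrightarrow> V = U"
  proof (rule subset_Zorn_nonempty)
    have "{} \<in> \<A>" using K by (simp add: \<A>_def)
    then show "\<A> \<noteq> {}" by blast
    fix \<C> assume ne: "\<C> \<noteq> {}" and ch: "subset.chain \<A> \<C>"
    then have sub: "\<And>U. U \<in> \<C> \<Longrightarrow> U \<subseteq> K \<and> good (K - U)"
      by (auto simp: subset.chain_def \<A>_def)
    have eq: "K - \<Union>\<C> = (\<Inter>U\<in>\<C>. K - U)" using ne by blast
    have "K \<inter> (\<Inter>U\<in>\<C>. K - U) \<noteq> {}"
    proof (rule compact_imp_fip_image[OF K(2)])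
      show "closed (K - U)" if "U \<in> \<C>" for U using sub[OF that] by (simp add: good_def)
      fix \<D> assume fin: "finite \<D>" and \<D>: "\<D> \<subseteq> \<C>"
      show "K \<inter> (\<Inter>U\<in>\<D>. K - U) \<noteq> {}"
      proof (cases "\<D> = {}")
        case True
        then show ?thesis using K by (simp add: good_def)
      next
        case False
        \<comment> \<open>A finite chain contains its union, whose complement is nonempty.\<close>
        have "subset.chain \<A> \<D>" using ch \<D> unfolding subset_chain_def by (meson subset_iff)
        then have "\<Union>\<D> \<in> \<D>" using False fin by (intro Union_in_chain)
        then have "good (K - \<Union>\<D>)" using sub[of "\<Union>\<D>"] \<D> by auto
        then show ?thesis using False by (auto simp: good_def)
      qed
    qed
    moreover have "closed (\<Inter>U\<in>\<C>. K - U)"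
      using sub by (intro closed_INT) (simp add: good_def)
    moreover have "\<phi> g ` (\<Inter>U\<in>\<C>. K - U) \<subseteq> (\<Inter>U\<in>\<C>. K - U)" if "g \<in> carrier G" for g
    proof (rule INT_greatest)
      fix U assume U: "U \<in> \<C>"
      then have "\<phi> g ` (\<Inter>U\<in>\<C>. K - U) \<subseteq> \<phi> g ` (K - U)" by (intro image_mono INT_lower)
      also have "\<dots> \<subseteq> K - U" using sub[OF U] that by (simp add: good_def)
      finally show "\<phi> g ` (\<Inter>U\<in>\<C>. K - U) \<subseteq> K - U" .
    qed
    ultimately have "good (K - \<Union>\<C>)"
      using ne unfolding eq good_def by (intro conjI ballI) auto
    then show "\<Union>\<C> \<in> \<A>" using sub by (auto simp: \<A>_def)
  qed
  then obtain U where U: "U \<subseteq> K" "good (K - U)"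
    and max: "\<And>V. V \<subseteq> K \<Longrightarrow> good (K - V) \<Longrightarrow> U \<subseteq> V \<Longrightarrow> V = U"
    by (auto simp: \<A>_def)
  have "closure (orbit G \<phi> w) = K - U" if w: "w \<in> K - U" for w
  proof -
    have wX: "w \<in> X" using w K by blast
    have sub: "closure (orbit G \<phi> w) \<subseteq> K - U"
      using U(2) w by (intro orbit_closure_subset) (auto simp: good_def)
    have "good (closure (orbit G \<phi> w))"
      using orbit_closure_invariant[OF wX] self_in_orbit_closure[OF wX] by (auto simp: good_def)
    moreover have "K - (K - closure (orbit G \<phi> w)) = closure (orbit G \<phi> w)" using sub by blast
    ultimately have "K - closure (orbit G \<phi> w) = U"
      using sub U(1) by (intro max) auto
    then show ?thesis using sub by blast
  qed
  then have "minimal_component G \<phi> K (K - U)"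
    using U by (auto simp: minimal_component_def good_def)
  then show ?thesis unfolding K_def by blast
qed

lemma minimal_component_mono:
  "minimal_component G \<phi> Y M \<Longrightarrow> Y \<subseteq> Z \<Longrightarrow> minimal_component G \<phi> Z M"
  unfolding minimal_component_def by blast

lemma minimal_component_disjoint:
  assumes "minimal_component G \<phi> Y M" "minimal_component G \<phi> Z N" "M \<noteq> N"
  shows "M \<inter> N = {}"
  using assms unfolding minimal_component_def by blast

section \<open>Passing averaged closeness to orbit closures\<close>

lemma average_infdist_le_closed:
  assumes A: "A \<subseteq> carrier G" and O: "orb \<subseteq> X"
    and le: "\<And>y. y \<in> orb \<Longrightarrow> (\<Sum>f\<in>A. infdist (\<phi> f y) M) \<le> c"
    and y: "y \<in> closure orb"
  shows "(\<Sum>f\<in>A. infdist (\<phi> f y) M) \<le> c"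
proof (rule continuous_le_on_closure[OF _ y le])
  have "closure orb \<subseteq> X" using O closed_space by (rule closure_minimal)
  then show "continuous_on (closure orb) (\<lambda>y. \<Sum>f\<in>A. infdist (\<phi> f y) M)"
    using A continuous by (intro continuous_intros) (blast intro: continuous_on_subset)
qed

text \<open>The bound on the pair \<open>(x, z)\<close> is inherited by a limit pair \<open>(a, b)\<close> of its orbit with
  \<open>a \<in> M\<close>. There \<open>\<phi> f (\<phi> g a)\<close> stays in \<open>M\<close>, so the distance of the pair dominates the
  distance to \<open>M\<close>, a quantity that involves \<open>b\<close> alone.\<close>

lemma pair_average_le_imp_near_component:
  assumes x: "x \<in> X" and z: "z \<in> X" and A: "A \<subseteq> carrier G"
    and le: "\<And>g. g \<in> carrier G \<Longrightarrow>
      (\<Sum>f\<in>A. dist (\<phi> f (\<phi> g x)) (\<phi> f (\<phi> g z))) \<le> c"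
    and M: "minimal_component G \<phi> (closure (orbit G \<phi> x)) M"
  obtains N where "minimal_component G \<phi> (closure (orbit G \<phi> z)) N"
    and "\<And>y. y \<in> N \<Longrightarrow> (\<Sum>f\<in>A. infdist (\<phi> f y) M) \<le> c"
proof -
  obtain a where a: "a \<in> M" "a \<in> closure (orbit G \<phi> x)"
    using M unfolding minimal_component_def by blast
  then obtain s where s: "\<And>n. s n \<in> orbit G \<phi> x" "s \<longlonglongrightarrow> a"
    unfolding closure_sequential by blast
  then have "\<forall>n. \<exists>h. h \<in> carrier G \<and> s n = \<phi> h x" by (auto simp: orbit_def)
  then obtain h where h: "\<And>n. h n \<in> carrier G" "\<And>n. s n = \<phi> (h n) x" by metis
  have "\<forall>n. \<phi> (h n) z \<in> X" using h z by simp
  then obtain b r where b: "b \<in> X" and r: "strict_mono r"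
    and lim: "((\<lambda>n. \<phi> (h n) z) \<circ> r) \<longlonglongrightarrow> b"
    using compact unfolding compact_def by meson
  have lim_b: "(\<lambda>n. \<phi> (h (r n)) z) \<longlonglongrightarrow> b" using lim by (simp add: o_def)
  have lim_a: "(\<lambda>n. \<phi> (h (r n)) x) \<longlonglongrightarrow> a"
    using LIMSEQ_subseq_LIMSEQ[OF s(2) r] h by (simp add: o_def)
  have aX: "a \<in> X" using a orbit_closure_subset_space[OF x] by blast
  have bz: "b \<in> closure (orbit G \<phi> z)"
    unfolding closure_sequential using h(1) lim_b by (intro exI conjI) (auto simp: orbit_def)
  have act_lim: "(\<lambda>n. \<phi> k (s n)) \<longlonglongrightarrow> \<phi> k l"
    if "k \<in> carrier G" "l \<in> X" "\<And>n. s n \<in> X" "s \<longlonglongrightarrow> l" for k l and s :: "nat \<Rightarrow> 'x"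
    using continuous_on_tendsto_compose[OF continuous[OF that(1)] that(4,2)] that(3) by simp
  have near_orbit: "(\<Sum>f\<in>A. infdist (\<phi> f (\<phi> g b)) M) \<le> c" if g: "g \<in> carrier G" for g
  proof -
    have "(\<lambda>n. \<Sum>f\<in>A. dist (\<phi> f (\<phi> g (\<phi> (h (r n)) x))) (\<phi> f (\<phi> g (\<phi> (h (r n)) z))))
      \<longlonglongrightarrow> (\<Sum>f\<in>A. dist (\<phi> f (\<phi> g a)) (\<phi> f (\<phi> g b)))"
      using A g h x z aX b lim_a lim_b by (intro tendsto_sum tendsto_dist act_lim) auto
    moreover have "(\<Sum>f\<in>A. dist (\<phi> f (\<phi> g (\<phi> (h (r n)) x))) (\<phi> f (\<phi> g (\<phi> (h (r n)) z)))) \<le> c" for n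
      using le[of "g \<otimes> h (r n)"] g h x z by (simp add: composition_rule)
    ultimately have "(\<Sum>f\<in>A. dist (\<phi> f (\<phi> g a)) (\<phi> f (\<phi> g b))) \<le> c"
      by (meson LIMSEQ_le_const2)
    moreover have "infdist (\<phi> f (\<phi> g b)) M \<le> dist (\<phi> f (\<phi> g a)) (\<phi> f (\<phi> g b))" if "f \<in> A" for f
    proof -
      have "\<phi> f (\<phi> g a) \<in> M"
        using M a(1) g A that unfolding minimal_component_def by blast
      then show ?thesis using infdist_le by (metis dist_commute)
    qed
    ultimately show ?thesis by (meson order_trans sum_mono)
  qed
  obtain N where N: "minimal_component G \<phi> (closure (orbit G \<phi> b)) N"
    using minimal_component_exists[OF b] by blast
  have "closure (orbit G \<phi> b) \<subseteq> closure (orbit G \<phi> z)"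
    using orbit_closure_invariant[OF z] bz by (intro orbit_closure_subset) auto
  then have "minimal_component G \<phi> (closure (orbit G \<phi> z)) N"
    using N minimal_component_mono by blast
  moreover have "(\<Sum>f\<in>A. infdist (\<phi> f y) M) \<le> c" if "y \<in> N" for y
  proof (rule average_infdist_le_closed[OF A])
    show "orbit G \<phi> b \<subseteq> X" using b by (auto simp: orbit_def)
    show "y \<in> closure (orbit G \<phi> b)" using N that unfolding minimal_component_def by blast
  qed (auto simp: orbit_def near_orbit)
  ultimately show thesis by (rule that)
qed

lemma minimal_components_separated:
  assumes fin: "finite \<T>"
    and \<T>: "\<And>M. M \<in> \<T> \<Longrightarrow> minimal_component G \<phi> X M"
  obtains \<delta> where "\<delta> > 0"
    and "\<And>M M'. M \<in> \<T> \<Longrightarrow> M' \<in> \<T> \<Longrightarrow> M \<noteq> M' \<Longrightarrow> \<delta> \<le> setdist M M'"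
proof -
  define D where "D = insert 1 ((\<lambda>(M, M'). setdist M M') ` {p \<in> \<T> \<times> \<T>. fst p \<noteq> snd p})"
  have finD: "finite D" unfolding D_def using fin by simp
  have "setdist M M' > 0" if "M \<in> \<T>" "M' \<in> \<T>" "M \<noteq> M'" for M M'
  proof -
    have "compact M" "closed M'" "M \<noteq> {}" "M' \<noteq> {}"
      using \<T>[OF that(1)] \<T>[OF that(2)]
      by (auto simp: minimal_component_def intro: closed_subset_compact)
    moreover have "M \<inter> M' = {}"
      using minimal_component_disjoint \<T> that by blast
    ultimately show ?thesis
      using setdist_eq_0_compact_closed setdist_pos_le by (metis less_eq_real_def)
  qed
  then have "Min D > 0" using finD by (subst Min_gr_iff) (auto simp: D_def)
  moreover have "Min D \<le> setdist M M'" if "M \<in> \<T>" "M' \<in> \<T>" "M \<noteq> M'" for M M'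
    using that finD by (intro Min_le) (force simp: D_def)+
  ultimately show thesis by (rule that)
qed

text \<open>Two components cannot be shadowed by the same \<open>N\<close>: averaging
  \<open>setdist M M' \<le> infdist p M + infdist p M'\<close> with \<open>p = \<phi> f y\<close> over \<open>f \<in> A\<close>
  would give \<open>setdist M M' \<le> 2 * \<epsilon>\<close>.\<close>

lemma minimal_components_shadowed:
  fixes \<epsilon> :: real
  assumes x: "x \<in> X" and z: "z \<in> X" and A: "A \<subseteq> carrier G" "finite A" "A \<noteq> {}"
    and le: "\<And>g. g \<in> carrier G \<Longrightarrow>
      (\<Sum>f\<in>A. dist (\<phi> f (\<phi> g x)) (\<phi> f (\<phi> g z))) \<le> \<epsilon> * card A"
    and \<T>: "\<And>M. M \<in> \<T> \<Longrightarrow> minimal_component G \<phi> (closure (orbit G \<phi> x)) M"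
    and sep: "\<And>M M'. M \<in> \<T> \<Longrightarrow> M' \<in> \<T> \<Longrightarrow> M \<noteq> M' \<Longrightarrow> 2 * \<epsilon> < setdist M M'"
  shows "\<exists>j. inj_on j \<T> \<and>
    (\<forall>M\<in>\<T>. minimal_component G \<phi> (closure (orbit G \<phi> z)) (j M))"
proof -
  have "\<exists>N. minimal_component G \<phi> (closure (orbit G \<phi> z)) N
      \<and> (\<forall>y\<in>N. (\<Sum>f\<in>A. infdist (\<phi> f y) M) \<le> \<epsilon> * card A)" if "M \<in> \<T>" for M
    using pair_average_le_imp_near_component[OF x z A(1) le \<T>[OF that]] by metis
  then obtain j where j: "\<And>M. M \<in> \<T> \<Longrightarrow> minimal_component G \<phi> (closure (orbit G \<phi> z)) (j M)"
    and near: "\<And>M y. M \<in> \<T> \<Longrightarrow> y \<in> j M \<Longrightarrow> (\<Sum>f\<in>A. infdist (\<phi> f y) M) \<le> \<epsilon> * card A"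
    by metis
  have "inj_on j \<T>"
  proof (rule inj_onI, rule ccontr)
    fix M M' assume MM': "M \<in> \<T>" "M' \<in> \<T>" "j M = j M'" "M \<noteq> M'"
    obtain y where y: "y \<in> j M"
      using j[OF MM'(1)] unfolding minimal_component_def by blast
    have "setdist M M' * card A = (\<Sum>f\<in>A. setdist M M')" by simp
    also have "\<dots> \<le> (\<Sum>f\<in>A. infdist (\<phi> f y) M + infdist (\<phi> f y) M')"
      by (intro sum_mono) (metis infdist_eq_setdist setdist_triangle setdist_sym)
    also have "\<dots> \<le> (2 * \<epsilon>) * card A"
      using near[OF MM'(1) y] near[OF MM'(2), of y] y MM'(3) by (simp add: sum.distrib)
    finally have "setdist M M' \<le> 2 * \<epsilon>"
      using A by (simp add: card_gt_0_iff)
    with sep[OF MM'(1,2,4)] show False by simp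
  qed
  with j show ?thesis by blast
qed

section \<open>From the Weyl pseudometric to averages\<close>

lemma sum_r_coset:
  assumes "A \<subseteq> carrier G" "g \<in> carrier G" "x \<in> X" "z \<in> X"
  shows "(\<Sum>f\<in>A #> g. dist (\<phi> f x) (\<phi> f z))
    = (\<Sum>f\<in>A. dist (\<phi> f (\<phi> g x)) (\<phi> f (\<phi> g z)))"
proof -
  have "A #> g = (\<lambda>f. f \<otimes> g) ` A" by (auto simp: r_coset_def)
  moreover have "inj_on (\<lambda>f. f \<otimes> g) A"
    using assms by (intro inj_onI) (metis right_cancel subsetD)
  ultimately have "(\<Sum>f\<in>A #> g. dist (\<phi> f x) (\<phi> f z))
      = (\<Sum>f\<in>A. dist (\<phi> (f \<otimes> g) x) (\<phi> (f \<otimes> g) z))"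
    by (simp add: sum.reindex)
  also have "\<dots> = (\<Sum>f\<in>A. dist (\<phi> f (\<phi> g x)) (\<phi> f (\<phi> g z)))"
    using assms by (intro sum.cong) (auto simp: composition_rule subset_iff)
  finally show ?thesis .
qed

text \<open>One index \<open>n\<close> is enough: the inner supremum already makes the bound uniform over the
  group, which is what passing to orbit closures requires.\<close>

lemma weyl_dist_less_imp_average_le:
  assumes F: "\<And>n. F n \<noteq> {} \<and> finite (F n) \<and> F n \<subseteq> carrier G"
    and x: "x \<in> X" and z: "z \<in> X" and less: "weyl_dist G \<phi> F z x < ereal \<epsilon>"
  obtains n where "\<And>g. g \<in> carrier G \<Longrightarrow>
    (\<Sum>f\<in>F n. dist (\<phi> f (\<phi> g x)) (\<phi> f (\<phi> g z))) \<le> \<epsilon> * card (F n)"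
proof -
  obtain n where n: "1 / real (card (F n)) *
      (SUP g\<in>carrier G. \<Sum>f\<in>F n #> g. dist (\<phi> f z) (\<phi> f x)) < \<epsilon>"
    using Limsup_lessD[OF less[unfolded weyl_dist_def]] by (auto simp: eventually_sequentially)
  have card: "0 < card (F n)" using F[of n] by (simp add: card_gt_0_iff)
  have avg: "(\<Sum>f\<in>F n. dist (\<phi> f (\<phi> g x)) (\<phi> f (\<phi> g z))) \<le> \<epsilon> * card (F n)"
    if g: "g \<in> carrier G" for g
  proof -
    \<comment> \<open>The supremum bounds its terms only because the sums are bounded above.\<close>
    have "bdd_above ((\<lambda>g. \<Sum>f\<in>F n #> g. dist (\<phi> f z) (\<phi> f x)) ` carrier G)"
    proof (rule bdd_aboveI2)
      fix k assume k: "k \<in> carrier G"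
      have "(\<Sum>f\<in>F n #> k. dist (\<phi> f z) (\<phi> f x))
          = (\<Sum>f\<in>F n. dist (\<phi> f (\<phi> k z)) (\<phi> f (\<phi> k x)))"
        using F k x z by (intro sum_r_coset) auto
      also have "\<dots> \<le> (\<Sum>f\<in>F n. diameter X)"
        using F[of n] k x z compact_imp_bounded[OF compact]
        by (intro sum_mono diameter_bounded_bound) (auto simp: subset_iff)
      finally show "(\<Sum>f\<in>F n #> k. dist (\<phi> f z) (\<phi> f x)) \<le> (\<Sum>f\<in>F n. diameter X)" .
    qed
    then have "(\<Sum>f\<in>F n #> g. dist (\<phi> f z) (\<phi> f x))
        \<le> (SUP g\<in>carrier G. \<Sum>f\<in>F n #> g. dist (\<phi> f z) (\<phi> f x))"
      using g by (intro cSUP_upper)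
    also have "\<dots> \<le> \<epsilon> * card (F n)" using n card by (simp add: field_simps)
    also have "(\<Sum>f\<in>F n #> g. dist (\<phi> f z) (\<phi> f x))
        = (\<Sum>f\<in>F n. dist (\<phi> f (\<phi> g x)) (\<phi> f (\<phi> g z)))"
      using F g x z sum_r_coset[of "F n" g z x] by (simp add: dist_commute)
    finally show ?thesis .
  qed
  then show thesis by (rule that)
qed

end

section \<open>Lower semicontinuity of the number of minimal components\<close>

lemma enat_le_num_minimal_components_iff:
  "enat k \<le> num_minimal_components G \<phi> x \<longleftrightarrow>
    (\<exists>\<T>. finite \<T> \<and> card \<T> = k \<and>
      (\<forall>M\<in>\<T>. minimal_component G \<phi> (closure (orbit G \<phi> x)) M))"
proof -
  define \<M> where "\<M> = {M. minimal_component G \<phi> (closure (orbit G \<phi> x)) M}"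
  have num: "num_minimal_components G \<phi> x = (if finite \<M> then enat (card \<M>) else \<infinity>)"
    by (simp add: num_minimal_components_def \<M>_def)
  have "enat k \<le> num_minimal_components G \<phi> x \<longleftrightarrow> (\<exists>\<T>. finite \<T> \<and> card \<T> = k \<and> \<T> \<subseteq> \<M>)"
  proof (cases "finite \<M>")
    case True
    then show ?thesis unfolding num by (auto intro: card_mono elim: obtain_subset_with_card_n)
  next
    case False
    then show ?thesis unfolding num using infinite_arbitrarily_large[OF False, of k] by auto
  qed
  then show ?thesis by (simp add: \<M>_def subset_iff Ball_def)
qed

theorem theorem35:
  fixes G :: "('g, 'b) monoid_scheme"
    and X :: "'x::metric_space set"
    and \<phi> :: "'g \<Rightarrow> 'x \<Rightarrow> 'x"
    and F :: "nat \<Rightarrow> 'g set"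
    and x :: 'x
    and xs :: "nat \<Rightarrow> 'x"
  assumes "group G" and "countable (carrier G)" and "amenable G"
    and "compact X" and "diameter X \<le> 1"
    and "group_action G X \<phi>"
    and "continuous_map (prod_topology (discrete_topology (carrier G)) (top_of_set X))
           (top_of_set X) (\<lambda>(g, y). \<phi> g y)"
    and "folner_sequence G F"
    and "x \<in> X" and "\<And>n. xs n \<in> X"
    and "(\<lambda>n. weyl_dist G \<phi> F (xs n) x) \<longlonglongrightarrow> 0"
  shows "num_minimal_components G \<phi> x \<le> liminf (\<lambda>n. num_minimal_components G \<phi> (xs n))"
proof -
  have "continuous_on X (\<phi> g)" if g: "g \<in> carrier G" for g
  proof -
    have "continuous_map (top_of_set X)
        (prod_topology (discrete_topology (carrier G)) (top_of_set X)) (\<lambda>y. (g, y))"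
      using g by (simp add: continuous_map_pairedI)
    from continuous_map_compose[OF this assms(7)] show ?thesis
      by (simp add: o_def continuous_map_in_subtopology)
  qed
  then interpret compact_action G X \<phi>
    using assms(4,6) by (simp add: compact_action_def compact_action_axioms_def)
  have F: "\<And>n. F n \<noteq> {} \<and> finite (F n) \<and> F n \<subseteq> carrier G"
    using assms(8) by (simp add: folner_sequence_def)
  show ?thesis
    unfolding le_Liminf_iff
  proof (intro allI impI)
    fix c assume c: "c < num_minimal_components G \<phi> x"
    then obtain k where k: "c = enat k" by (cases c) auto
    with c have "enat (Suc k) \<le> num_minimal_components G \<phi> x"
      by (metis Suc_ile_eq)
    then obtain \<T> where \<T>: "finite \<T>" "card \<T> = Suc k"
      and comp: "\<And>M. M \<in> \<T> \<Longrightarrow> minimal_component G \<phi> (closure (orbit G \<phi> x)) M"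
      unfolding enat_le_num_minimal_components_iff by blast
    obtain \<delta> where \<delta>: "\<delta> > 0"
      and sep: "\<And>M M'. M \<in> \<T> \<Longrightarrow> M' \<in> \<T> \<Longrightarrow> M \<noteq> M' \<Longrightarrow> \<delta> \<le> setdist M M'"
      using minimal_components_separated[OF \<T>(1)]
        minimal_component_mono[OF comp orbit_closure_subset_space[OF assms(9)]] by metis
    have "enat (Suc k) \<le> num_minimal_components G \<phi> (xs m)"
      if "weyl_dist G \<phi> F (xs m) x < ereal (\<delta> / 3)" for m
    proof -
      obtain n where n: "\<And>g. g \<in> carrier G \<Longrightarrow>
          (\<Sum>f\<in>F n. dist (\<phi> f (\<phi> g x)) (\<phi> f (\<phi> g (xs m)))) \<le> \<delta> / 3 * card (F n)"
        using weyl_dist_less_imp_average_le[OF F assms(9,10) \<open>weyl_dist _ _ _ _ _ < _\<close>] by metis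
      have sep': "2 * (\<delta> / 3) < setdist M M'" if "M \<in> \<T>" "M' \<in> \<T>" "M \<noteq> M'" for M M'
        using sep[OF that] \<delta> by simp
      have "\<exists>j. inj_on j \<T> \<and>
          (\<forall>M\<in>\<T>. minimal_component G \<phi> (closure (orbit G \<phi> (xs m))) (j M))"
      proof (rule minimal_components_shadowed[OF assms(9,10)])
        show "F n \<subseteq> carrier G" "finite (F n)" "F n \<noteq> {}" using F by auto
      next
        fix g assume "g \<in> carrier G"
        then show "(\<Sum>f\<in>F n. dist (\<phi> f (\<phi> g x)) (\<phi> f (\<phi> g (xs m)))) \<le> \<delta> / 3 * card (F n)"
          by (rule n)
      qed (fact comp sep')+
      then obtain j where "inj_on j \<T>"
        and "\<And>M. M \<in> \<T> \<Longrightarrow> minimal_component G \<phi> (closure (orbit G \<phi> (xs m))) (j M)"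
        by blast
      then show ?thesis
        unfolding enat_le_num_minimal_components_iff using \<T>
        by (intro exI[of _ "j ` \<T>"]) (auto simp: card_image)
    qed
    moreover have "\<forall>\<^sub>F m in sequentially. weyl_dist G \<phi> F (xs m) x < ereal (\<delta> / 3)"
      using order_tendstoD(2)[OF assms(11)] \<delta> by (simp add: zero_ereal_def)
    ultimately have "\<forall>\<^sub>F m in sequentially. enat (Suc k) \<le> num_minimal_components G \<phi> (xs m)"
      by (simp add: eventually_mono)
    then show "\<forall>\<^sub>F m in sequentially. c < num_minimal_components G \<phi> (xs m)"
      unfolding k by (simp add: Suc_ile_eq)
  qed
qed

end
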